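(* For every fixed integer $\ell\ge1$, the function $\tau\mapsto s_\ell(\tau)$ is strictly increasing on $(0,\infty)$ and maps this interval onto $(0,2^{-2\ell})$.
   Context: For $\ell\in\mathbb{N}_0$ let $\mathrm{Sym}^{2\ell}\mathbb{C}^2$ be the space of homogeneous polynomials of degree $2\ell$ in $(z_0,z_1)$ with the Hermitian inner product for which the monomials are orthogonal and $\|z_0^{2\ell-k}z_1^k\|^2=\binom{2\ell}{k}^{-1}$. For $\tau>0$ put $u_\ell=z_0^{2\ell}$, $w_\ell(\tau)=(z_0^2+z_1^2+2\coth\tau\,z_0z_1)^\ell$, $\widehat v=v/\|v\|$, and $$s_\ell(\tau)=\bigl|\langle\widehat w_\ell(\tau),\widehat u_\ell\rangle\bigr|^2.$$ *)

theory Defs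
  imports "HOL-Computational_Algebra.Polynomial" Complex_Main
begin

(* Polynomials in z0, z1 over the complex numbers are represented as complex poly poly:
   z1 is the outer variable and z0 is the variable of the coefficient ring. *)

definition z0 :: "complex poly poly" where
  "z0 = [:[:0, 1:]:]"

definition z1 :: "complex poly poly" where
  "z1 = [:0, 1:]"

(* The coefficient of z0^i * z1^j. *)
definition bicoeff :: "complex poly poly \<Rightarrow> nat \<Rightarrow> nat \<Rightarrow> complex" where
  "bicoeff p i j = coeff (coeff p j) i"

definition cscale :: "complex \<Rightarrow> complex poly poly \<Rightarrow> complex poly poly" where
  "cscale c p = smult [:c:] p"

(* Sym^n C^2: the zero polynomial is included. *)
definition Sym :: "nat \<Rightarrow> complex poly poly set" where
  "Sym n = {p. \<forall>i j. bicoeff p i j \<noteq> 0 \<longrightarrow> i + j = n}"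

(* The inner product on Sym n, linear in the first argument, for which the monomials
   z0^(n-k) * z1^k are orthogonal with squared norm 1 / (n choose k); see
   sym_inner_monomials below. *)
definition sym_inner :: "nat \<Rightarrow> complex poly poly \<Rightarrow> complex poly poly \<Rightarrow> complex" where
  "sym_inner n p q =
     (\<Sum>k\<le>n. bicoeff p (n - k) k * cnj (bicoeff q (n - k) k) / of_nat (n choose k))"

definition sym_norm :: "nat \<Rightarrow> complex poly poly \<Rightarrow> real" where
  "sym_norm n p = sqrt (Re (sym_inner n p p))"

definition normalized :: "nat \<Rightarrow> complex poly poly \<Rightarrow> complex poly poly" where
  "normalized n p = cscale (complex_of_real (1 / sym_norm n p)) p"

definition coth :: "real \<Rightarrow> real" where
  "coth t = cosh t / sinh t"

definition u_vec :: "nat \<Rightarrow> complex poly poly" where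
  "u_vec l = z0 ^ (2 * l)"

definition w_vec :: "nat \<Rightarrow> real \<Rightarrow> complex poly poly" where
  "w_vec l \<tau> = (z0\<^sup>2 + z1\<^sup>2 + cscale (complex_of_real (2 * coth \<tau>)) (z0 * z1)) ^ l"

definition s_fun :: "nat \<Rightarrow> real \<Rightarrow> real" where
  "s_fun l \<tau> = (cmod (sym_inner (2 * l) (normalized (2 * l) (w_vec l \<tau>)) (normalized (2 * l) (u_vec l))))\<^sup>2"

lemma z0_power: "z0 ^ i = [:monom 1 i:]"
  by (induction i) (simp_all add: z0_def monom_Suc one_pCons)

lemma bicoeff_monomial:
  "bicoeff (z0 ^ i * z1 ^ j) i' j' = (if i' = i \<and> j' = j then 1 else 0)"
proof -
  have "z1 ^ j = monom 1 j"
    by (simp add: z1_def monom_altdef)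
  then show ?thesis
    by (simp add: bicoeff_def z0_power smult_monom)
qed

lemma bicoeff_add: "bicoeff (p + q) i j = bicoeff p i j + bicoeff q i j"
  by (simp add: bicoeff_def)

lemma bicoeff_cscale: "bicoeff (cscale c p) i j = c * bicoeff p i j"
  by (simp add: bicoeff_def cscale_def)

lemma Sym_monomial: "i + j = n \<Longrightarrow> z0 ^ i * z1 ^ j \<in> Sym n"
  by (auto simp: Sym_def bicoeff_monomial)

lemma Sym_add:
  assumes "p \<in> Sym n" "q \<in> Sym n"
  shows "p + q \<in> Sym n"
  unfolding Sym_def
proof (intro CollectI allI impI)
  fix i j
  assume "bicoeff (p + q) i j \<noteq> 0"
  then have "bicoeff p i j \<noteq> 0 \<or> bicoeff q i j \<noteq> 0"
    by (auto simp: bicoeff_add)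
  then show "i + j = n"
    using assms unfolding Sym_def by blast
qed

lemma Sym_cscale: "p \<in> Sym n \<Longrightarrow> cscale c p \<in> Sym n"
  by (auto simp: Sym_def bicoeff_cscale)

lemma Sym_mult:
  assumes "p \<in> Sym m" "q \<in> Sym n"
  shows "p * q \<in> Sym (m + n)"
  unfolding Sym_def
proof (intro CollectI allI impI)
  fix i j
  assume nz: "bicoeff (p * q) i j \<noteq> 0"
  have "bicoeff (p * q) i j = (\<Sum>b\<le>j. \<Sum>a\<le>i. bicoeff p a b * bicoeff q (i - a) (j - b))"
    by (simp add: bicoeff_def coeff_mult coeff_sum)
  with nz obtain b where b: "b \<le> j" "(\<Sum>a\<le>i. bicoeff p a b * bicoeff q (i - a) (j - b)) \<noteq> 0"
    by (metis (no_types, lifting) atMost_iff sum.neutral)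
  then obtain a where a: "a \<le> i" "bicoeff p a b * bicoeff q (i - a) (j - b) \<noteq> 0"
    by (metis (no_types, lifting) atMost_iff sum.neutral)
  then have "a + b = m" "(i - a) + (j - b) = n"
    using assms by (auto simp: Sym_def)
  with a b show "i + j = m + n" by linarith
qed

lemma Sym_power: "p \<in> Sym m \<Longrightarrow> p ^ l \<in> Sym (m * l)"
proof (induction l)
  case 0
  show ?case using Sym_monomial[of 0 0 0] by simp
next
  case (Suc l)
  then show ?case using Sym_mult[of p m "p ^ l" "m * l"] by simp
qed

lemma u_in_Sym: "u_vec l \<in> Sym (2 * l)"
  using Sym_monomial[of "2 * l" 0] by (simp add: u_vec_def)

lemma w_in_Sym: "w_vec l \<tau> \<in> Sym (2 * l)"
proof -
  have "z0\<^sup>2 \<in> Sym 2" "z1\<^sup>2 \<in> Sym 2" "z0 * z1 \<in> Sym 2"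
    using Sym_monomial[of 2 0 2] Sym_monomial[of 0 2 2] Sym_monomial[of 1 1 2] by simp_all
  then show ?thesis
    unfolding w_vec_def by (intro Sym_power Sym_add Sym_cscale)
qed

lemma sym_inner_monomials:
  assumes "j \<le> n" "k \<le> n"
  shows "sym_inner n (z0 ^ (n - j) * z1 ^ j) (z0 ^ (n - k) * z1 ^ k) =
           (if j = k then 1 / of_nat (n choose k) else 0)"
proof -
  have "sym_inner n (z0 ^ (n - j) * z1 ^ j) (z0 ^ (n - k) * z1 ^ k) =
          (\<Sum>i\<le>n. if i = k then if j = k then 1 / of_nat (n choose k) else 0 else 0)"
    unfolding sym_inner_def by (rule sum.cong) (auto simp: bicoeff_monomial)
  then show ?thesis using assms by simp
qed

lemma sym_inner_add_left: "sym_inner n (p + p') q = sym_inner n p q + sym_inner n p' q"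
  by (simp add: sym_inner_def bicoeff_add algebra_simps add_divide_distrib sum.distrib)

lemma sym_inner_cscale_left: "sym_inner n (cscale c p) q = c * sym_inner n p q"
  by (simp add: sym_inner_def bicoeff_cscale sum_distrib_left mult.assoc)

lemma sym_inner_commute: "sym_inner n q p = cnj (sym_inner n p q)"
  by (simp add: sym_inner_def mult.commute)

lemma sym_inner_self:
  "sym_inner n p p =
     complex_of_real (\<Sum>k\<le>n. (cmod (bicoeff p (n - k) k))\<^sup>2 / real (n choose k))"
  by (simp add: sym_inner_def flip: complex_norm_square)

lemma sym_norm_pos:
  assumes "p \<in> Sym n" "p \<noteq> 0"
  shows "sym_norm n p > 0"
proof -
  obtain j where "coeff p j \<noteq> 0"
    using assms(2) by (metis leading_coeff_0_iff)
  then obtain i where ij: "bicoeff p i j \<noteq> 0"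
    unfolding bicoeff_def by (metis leading_coeff_0_iff)
  then have "i + j = n"
    using assms(1) by (auto simp: Sym_def)
  then have "j \<le> n" "bicoeff p (n - j) j \<noteq> 0"
    using ij by auto
  then have "(\<Sum>k\<le>n. (cmod (bicoeff p (n - k) k))\<^sup>2 / real (n choose k)) > 0"
    by (intro sum_pos2[where i = j]) (auto simp: zero_less_binomial_iff)
  then show ?thesis
    by (simp add: sym_norm_def sym_inner_self)
qed

end

theory Submission
  imports Defs
begin

text \<open>Only the \<open>z0 ^ (2 * l)\<close> component of \<open>w\<close>, which is 1, pairs with \<open>u\<close>, so \<open>s_l\<close> is the reciprocal of
  \<open>\<parallel>w\<parallel>\<^sup>2\<close>. With \<open>c = 2 coth \<tau>\<close> and \<open>a_k\<close> the coefficients of \<open>(1 + c x + x\<^sup>2)^l\<close>,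
  \<open>\<parallel>w\<parallel>\<^sup>2 = \<Sum>k. a_k\<^sup>2 / (2 l choose k)\<close>. Each \<open>a_k\<close> is a polynomial in \<open>c\<close> with nonnegative
  coefficients and \<open>a_1 = l c\<close>, so the sum increases strictly and continuously to infinity, starting
  at \<open>c = 2\<close> from \<open>\<Sum>k. (2 l choose k) = 2^(2 l)\<close>; and \<open>\<tau> \<mapsto> 2 coth \<tau>\<close> is a decreasing
  bijection onto \<open>(2, \<infinity>)\<close>.\<close>

text \<open>Homogeneity leaves a single power of \<open>z0\<close> beside each power of
  \<open>z1\<close>, so substituting \<open>z0 = 1\<close> loses no information.\<close>

lemma Sym_coeff_eq_monom:
  assumes "p \<in> Sym n" "k \<le> n"
  shows "coeff p k = monom (bicoeff p (n - k) k) (n - k)"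
proof (rule poly_eqI)
  fix i
  have "i + k = n" if "bicoeff p i k \<noteq> 0"
    using assms(1) that by (auto simp: Sym_def)
  then show "coeff (coeff p k) i = coeff (monom (bicoeff p (n - k) k) (n - k)) i"
    using assms(2) by (cases "coeff (coeff p k) i = 0") (auto simp: bicoeff_def)
qed

lemma bicoeff_eq_poly_1:
  assumes "p \<in> Sym n" "k \<le> n"
  shows "bicoeff p (n - k) k = poly (coeff p k) 1"
  by (simp add: Sym_coeff_eq_monom[OF assms] poly_monom)

text \<open>Setting \<open>z0 = 1\<close> respects products, so the coefficients of the power follow
  from those of the base by induction on the Cauchy product.\<close>

lemma poly_1_coeff_w_vec:
  "poly (coeff (w_vec l \<tau>) k) 1 = complex_of_real (coeff ([:1, 2 * coth \<tau>, 1:] ^ l) k)"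
proof -
  define Q where "Q = z0\<^sup>2 + z1\<^sup>2 + cscale (complex_of_real (2 * coth \<tau>)) (z0 * z1)"
  define q where "q = [:1, 2 * coth \<tau>, 1:]"
  have Q: "poly (coeff Q i) 1 = complex_of_real (coeff q i)" for i
    unfolding Q_def q_def
    by (simp add: z0_def z1_def cscale_def power2_eq_square coeff_pCons split: nat.split)
  have "poly (coeff (Q ^ l) k) 1 = complex_of_real (coeff (q ^ l) k)"
    by (induction l arbitrary: k) (simp_all add: coeff_mult poly_sum Q)
  then show ?thesis
    by (simp add: Q_def q_def w_vec_def)
qed

definition w_norm_sq :: "nat \<Rightarrow> real \<Rightarrow> real" where
  "w_norm_sq l c = (\<Sum>k\<le>2 * l. (coeff ([:1, c, 1:] ^ l) k)\<^sup>2 / real (2 * l choose k))"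

text \<open>Nonnegativity is carried through the induction because comparing the products in the
  convolution termwise requires it.\<close>

lemma coeff_quadratic_power_mono:
  fixes c d :: real
  assumes "0 \<le> c" "c \<le> d"
  shows "0 \<le> coeff ([:1, c, 1:] ^ l) k \<and> coeff ([:1, c, 1:] ^ l) k \<le> coeff ([:1, d, 1:] ^ l) k"
proof (induction l arbitrary: k)
  case (Suc l)
  have "0 \<le> coeff [:1, c, 1:] i \<and> coeff [:1, c, 1:] i \<le> coeff [:1, d, 1:] i" for i
    using assms by (simp add: coeff_pCons split: nat.split)
  with Suc.IH show ?case
    by (auto simp only: power_Suc coeff_mult
        intro!: sum_nonneg sum_mono mult_mono mult_nonneg_nonneg intro: order_trans)
qed simp

lemma continuous_on_coeff_quadratic_power:
  "continuous_on A (\<lambda>c::real. coeff ([:1, c, 1:] ^ l) k)"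
proof (induction l arbitrary: k)
  case (Suc l)
  have "continuous_on A (\<lambda>c::real. coeff [:1, c, 1:] i)" for i
    by (cases i; cases "i - 1") (auto simp: coeff_pCons)
  with Suc.IH show ?case
    by (auto simp only: power_Suc coeff_mult intro!: continuous_intros)
qed simp

lemma coeff_quadratic_power_0: "coeff ([:1, c, 1:] ^ l) 0 = (1::real)"
  by (simp flip: poly_0_coeff_0)

lemma coeff_quadratic_power_1: "coeff ([:1, c, 1:] ^ l) 1 = real l * c"
proof (induction l)
  case (Suc l)
  then show ?case
    using coeff_quadratic_power_0[of c l] by (simp add: coeff_mult algebra_simps)
qed simp

lemma continuous_on_w_norm_sq: "continuous_on A (w_norm_sq l)"
  unfolding w_norm_sq_def
  by (intro continuous_intros continuous_on_coeff_quadratic_power) simp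

lemma w_norm_sq_strict_mono:
  assumes "l \<ge> 1" "0 \<le> c" "c < d"
  shows "w_norm_sq l c < w_norm_sq l d"
  unfolding w_norm_sq_def
proof (rule sum_strict_mono_ex1)
  show "\<forall>k\<in>{..2 * l}. (coeff ([:1, c, 1:] ^ l) k)\<^sup>2 / real (2 * l choose k)
      \<le> (coeff ([:1, d, 1:] ^ l) k)\<^sup>2 / real (2 * l choose k)"
    using coeff_quadratic_power_mono[of c d l] assms
    by (auto intro!: divide_right_mono power_mono)
  \<comment> \<open>The term \<open>k = 1\<close> supplies the strictness.\<close>
  have "(l * c)\<^sup>2 < (l * d)\<^sup>2"
    using assms by (intro power_strict_mono) auto
  then show "\<exists>k\<in>{..2 * l}. (coeff ([:1, c, 1:] ^ l) k)\<^sup>2 / real (2 * l choose k)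
      < (coeff ([:1, d, 1:] ^ l) k)\<^sup>2 / real (2 * l choose k)"
    using assms(1) coeff_quadratic_power_1[of c l] coeff_quadratic_power_1[of d l]
    by (intro bexI[of _ 1]) (auto intro!: divide_strict_right_mono)
qed simp

text \<open>At \<open>c = 2\<close> the quadratic is a perfect square, so each coefficient is the
  very binomial it is weighted by.\<close>

lemma w_norm_sq_2: "w_norm_sq l 2 = 2 ^ (2 * l)"
proof -
  have "[:1, 2, 1:] = [:1, 1::real:]\<^sup>2"
    by (simp add: power2_eq_square)
  then have "[:1, 2, 1:] ^ l = [:1, 1::real:] ^ (2 * l)"
    by (simp add: power_mult)
  then have "w_norm_sq l 2 = (\<Sum>k\<le>2 * l. real (2 * l choose k))"
    by (simp add: w_norm_sq_def coeff_linear_poly_power power2_eq_square)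
  also have "\<dots> = 2 ^ (2 * l)"
    by (simp add: choose_row_sum flip: of_nat_sum)
  finally show ?thesis .
qed

text \<open>The term \<open>k = 1\<close> alone gives this bound, which makes the norm unbounded in
  \<open>c\<close>.\<close>

lemma w_norm_sq_ge:
  assumes "l \<ge> 1"
  shows "l * c\<^sup>2 / 2 \<le> w_norm_sq l c"
proof -
  have "l * c\<^sup>2 / 2 = (coeff ([:1, c, 1:] ^ l) 1)\<^sup>2 / real (2 * l choose 1)"
    unfolding coeff_quadratic_power_1 using assms by (simp add: power2_eq_square)
  also have "\<dots> \<le> w_norm_sq l c"
    unfolding w_norm_sq_def using assms by (intro member_le_sum) auto
  finally show ?thesis .
qed

lemma w_norm_sq_surj:
  assumes "l \<ge> 1" "2 ^ (2 * l) < y"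
  obtains c where "c > 2" "w_norm_sq l c = y"
proof -
  \<comment> \<open>Right end for the intermediate value theorem: \<open>M\<close> exceeds 2, and
    its square is at least \<open>2 * y\<close>.\<close>
  define M where "M = 2 + y"
  have "y > 0"
    using assms(2) by (rule less_trans[rotated]) simp
  then have "y \<le> M\<^sup>2 / 2"
    by (simp add: M_def power2_eq_square algebra_simps)
  also have "\<dots> \<le> l * M\<^sup>2 / 2"
    using assms(1) by (simp add: mult_le_cancel_right1)
  also have "\<dots> \<le> w_norm_sq l M"
    by (rule w_norm_sq_ge[OF assms(1)])
  finally have "\<exists>c\<ge>2. c \<le> M \<and> w_norm_sq l c = y"
    using \<open>y > 0\<close> assms(2) continuous_on_w_norm_sq
    by (intro IVT') (auto simp: M_def w_norm_sq_2)
  then obtain c where c: "c \<ge> 2" "w_norm_sq l c = y"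
    by blast
  then have "c \<noteq> 2"
    using assms(2) w_norm_sq_2[of l] by auto
  with c that[of c] show thesis
    by simp
qed

lemma s_fun_eq: "s_fun l \<tau> = 1 / w_norm_sq l (2 * coth \<tau>)"
proof -
  define c where "c = 2 * coth \<tau>"
  have w: "bicoeff (w_vec l \<tau>) (2 * l - k) k = complex_of_real (coeff ([:1, c, 1:] ^ l) k)"
    if "k \<le> 2 * l" for k
    using bicoeff_eq_poly_1[OF w_in_Sym that] by (simp add: poly_1_coeff_w_vec c_def)
  have "sym_inner (2 * l) (w_vec l \<tau>) (w_vec l \<tau>) = complex_of_real (w_norm_sq l c)"
    unfolding sym_inner_self w_norm_sq_def by (simp add: w)
  then have norm_w: "sym_norm (2 * l) (w_vec l \<tau>) = sqrt (w_norm_sq l c)"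
    by (simp add: sym_norm_def)
  have u: "bicoeff (u_vec l) i k = (if i = 2 * l \<and> k = 0 then 1 else 0)" for i k
    using bicoeff_monomial[of "2 * l" 0 i k] by (simp add: u_vec_def)
  have norm_u: "sym_norm (2 * l) (u_vec l) = 1"
    using sym_inner_monomials[of 0 "2 * l" 0] by (simp add: sym_norm_def u_vec_def)
  have "sym_inner (2 * l) (w_vec l \<tau>) (u_vec l) =
      (\<Sum>k\<le>2 * l. if k = 0 then bicoeff (w_vec l \<tau>) (2 * l) 0 else 0)"
    unfolding sym_inner_def by (rule sum.cong) (auto simp: u)
  also have "\<dots> = 1"
    using w[of 0] coeff_quadratic_power_0[of c l] by simp
  finally have inner: "sym_inner (2 * l) (w_vec l \<tau>) (u_vec l) = 1" .
  have "normalized (2 * l) (u_vec l) = u_vec l"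
    by (simp add: normalized_def norm_u cscale_def flip: one_pCons)
  \<comment> \<open>Needed for the square of \<open>sqrt (w_norm_sq l c)\<close> to
    collapse.\<close>
  moreover have "w_norm_sq l c \<ge> 0"
    by (simp add: w_norm_sq_def sum_nonneg)
  ultimately show ?thesis
    by (simp add: s_fun_def normalized_def[of _ "w_vec l \<tau>"] sym_inner_cscale_left inner norm_w
        norm_divide power_divide flip: c_def)
qed

lemma coth_eq_inverse_tanh: "coth \<tau> = 1 / tanh \<tau>"
  by (simp add: coth_def tanh_def)

lemma coth_gt_1: "\<tau> > 0 \<Longrightarrow> coth \<tau> > 1"
  by (simp add: coth_eq_inverse_tanh tanh_real_lt_1)

lemma coth_strict_antimono: "0 < \<sigma> \<Longrightarrow> \<sigma> < \<tau> \<Longrightarrow> coth \<tau> < coth \<sigma>"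
  by (simp add: coth_eq_inverse_tanh frac_less2)

lemma coth_surj:
  assumes "x > 1"
  obtains \<tau> where "\<tau> > 0" "coth \<tau> = x"
proof
  \<comment> \<open>This is the inverse hyperbolic tangent of \<open>1 / x\<close>.\<close>
  define \<tau> where "\<tau> = ln ((x + 1) / (x - 1)) / 2"
  have "exp (- 2 * \<tau>) = (x - 1) / (x + 1)"
    using assms by (simp add: \<tau>_def exp_minus)
  then have "tanh \<tau> = (1 - (x - 1) / (x + 1)) / (1 + (x - 1) / (x + 1))"
    by (simp only: tanh_real_altdef)
  also have "\<dots> = 1 / x"
    using assms by (simp add: divide_simps)
  finally show "coth \<tau> = x"
    by (simp add: coth_eq_inverse_tanh)
  show "\<tau> > 0"
    using assms by (simp add: \<tau>_def)
qed

theorem theorem7p3: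
  fixes l :: nat
  assumes "l \<ge> 1"
  shows "strict_mono_on {0<..} (\<lambda>\<tau>. s_fun l \<tau>) \<and>
         (\<lambda>\<tau>. s_fun l \<tau>) ` {0<..} = {0<..<1 / 2 ^ (2 * l)}"
proof
  have gt: "2 ^ (2 * l) < w_norm_sq l (2 * coth \<tau>)" if "\<tau> > 0" for \<tau>
    using w_norm_sq_strict_mono[OF assms, of 2 "2 * coth \<tau>"] coth_gt_1[OF that]
    by (simp add: w_norm_sq_2)
  have pos: "0 < w_norm_sq l (2 * coth \<tau>)" if "\<tau> > 0" for \<tau>
    using gt[OF that] by (rule less_trans[rotated]) simp
  show "strict_mono_on {0<..} (\<lambda>\<tau>. s_fun l \<tau>)"
  proof (rule strict_mono_onI)
    fix \<sigma> \<tau> :: real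
    assume "\<sigma> \<in> {0<..}" "\<tau> \<in> {0<..}" "\<sigma> < \<tau>"
    \<comment> \<open>\<open>coth\<close> reverses the order here, and the reciprocal in
      \<open>s_fun_eq\<close> reverses it back.\<close>
    then have "w_norm_sq l (2 * coth \<tau>) < w_norm_sq l (2 * coth \<sigma>)"
      using coth_gt_1[of \<tau>] coth_strict_antimono[of \<sigma> \<tau>]
      by (intro w_norm_sq_strict_mono[OF assms]) auto
    then show "s_fun l \<sigma> < s_fun l \<tau>"
      using pos \<open>\<tau> \<in> {0<..}\<close> by (simp add: s_fun_eq frac_less2)
  qed
  show "(\<lambda>\<tau>. s_fun l \<tau>) ` {0<..} = {0<..<1 / 2 ^ (2 * l)}"
  proof (intro equalityI subsetI)
    fix y assume "y \<in> (\<lambda>\<tau>. s_fun l \<tau>) ` {0<..}"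
    then show "y \<in> {0<..<1 / 2 ^ (2 * l)}"
      using gt pos by (auto simp: s_fun_eq intro!: frac_less2)
  next
    fix y :: real assume y: "y \<in> {0<..<1 / 2 ^ (2 * l)}"
    \<comment> \<open>A preimage of \<open>y\<close> comes from solving for the norm
      \<open>1 / y\<close> in \<open>c\<close> first, then for \<open>\<tau>\<close>.\<close>
    then have "2 ^ (2 * l) < 1 / y"
      by (simp add: field_simps)
    then obtain c where c: "c > 2" "w_norm_sq l c = 1 / y"
      using w_norm_sq_surj[OF assms] by blast
    then obtain \<tau> where "\<tau> > 0" "coth \<tau> = c / 2"
      using coth_surj[of "c / 2"] by auto
    then have "2 * coth \<tau> = c"
      by simp
    with c have "y = s_fun l \<tau>"
      by (simp only: s_fun_eq) simp
    with \<open>\<tau> > 0\<close> show "y \<in> (\<lambda>\<tau>. s_fun l \<tau>) ` {0<..}"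
      by simp
  qed
qed

end
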